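(* For infinitely many positive integers $\Delta$, there exist bipartite graphs $G$ and $H$ with bipartitions $(A_G,B_G)$ and $(A_H,B_H)$, respectively, such that $H$ is a bipartite correspondence-cover of $G$ with respect to some $L: A_G\to 2^{A_H},\ B_G\to 2^{B_H}$ and such that the following holds: the maximum degree of $G$ is $\Delta$, $|L(v)| = \Delta/\log_4\Delta$ for all $v\in A_G$, $|L(w)|=2$ for all $w\in B_G$, and $H$ does not admit an independent transversal with respect to $L$.
   Context: Graphs are simple and undirected; $\log_4$ is the logarithm to base $4$. Let $G$ and $H$ be bipartite graphs with bipartitions $(A_G,B_G)$ and $(A_H,B_H)$. $H$ is a bipartite cover of $G$ with respect to a mapping $L:V(G)\to 2^{V(H)}$ if: (a) $L$ induces a partition of $V(H)$, i.e. the sets $L(v)$, $v\in V(G)$, are nonempty, pairwise disjoint and have union $V(H)$, and there are no edges of $H$ between $L(v)$ and $L(v')$ whenever $vv'\notin E(G)$; and (b) the sets $L(v)$, $v\in A_G$, partition $A_H$ and the sets $L(w)$, $w\in B_G$, partition $B_H$ (this is what is meant by writing $L: A_G\to 2^{A_H}, B_G\to 2^{B_H}$). It is a bipartite correspondence-cover if, in addition, for each edge $vv'\in E(G)$ the subgraph of $H$ between $L(v)$ and $L(v')$ is a matching (not necessarily perfect, possibly empty). An independent transversal of $H$ with respect to $L$ is an independent set of $H$ that contains exactly one vertex of each $L(v)$, $v\in V(G)$. *)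

theory Defs
  imports Complex_Main "HOL-Library.Disjoint_Sets" "Graph_Theory.Pair_Digraph"
begin

text \<open>
  A finite simple undirected graph is an instance of \<^locale>\<open>pair_graph\<close>: a finite, loop-free,
  symmetric relation, in which an edge \<open>uv\<close> is represented by the two pairs \<open>(u,v)\<close> and \<open>(v,u)\<close>.
  In particular \<^const>\<open>out_degree\<close> is the usual degree.
\<close>

definition bipartite_graph :: "'a pair_pre_digraph \<Rightarrow> 'a set \<Rightarrow> 'a set \<Rightarrow> bool" where
  "bipartite_graph G A B \<longleftrightarrow>
     pair_graph G \<and> A \<union> B = pverts G \<and> A \<inter> B = {} \<and> parcs G \<subseteq> A \<times> B \<union> B \<times> A"

definition max_degree :: "'a pair_pre_digraph \<Rightarrow> nat" where
  "max_degree G = Max (out_degree (with_proj G) ` pverts G)"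

definition partition_by :: "'i set \<Rightarrow> ('i \<Rightarrow> 'a set) \<Rightarrow> 'a set \<Rightarrow> bool" where
  "partition_by I L S \<longleftrightarrow>
     (\<forall>i\<in>I. L i \<noteq> {}) \<and> disjoint_family_on L I \<and> (\<Union>i\<in>I. L i) = S"

definition edges_between :: "'a pair_pre_digraph \<Rightarrow> 'a set \<Rightarrow> 'a set \<Rightarrow> ('a \<times> 'a) set" where
  "edges_between H X Y = parcs H \<inter> X \<times> Y"

text \<open>
  The next definition is meant for sets of edges between two disjoint vertex sets, each edge being
  oriented from the first set to the second, so that distinct edges can only share an endpoint
  on the same side.
\<close>

definition bipartite_matching :: "('a \<times> 'a) set \<Rightarrow> bool" where
  "bipartite_matching M \<longleftrightarrow> (\<forall>e\<in>M. \<forall>e'\<in>M. e \<noteq> e' \<longrightarrow> fst e \<noteq> fst e' \<and> snd e \<noteq> snd e')"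

definition bipartite_cover ::
    "'a pair_pre_digraph \<Rightarrow> 'a set \<Rightarrow> 'a set \<Rightarrow> 'b pair_pre_digraph \<Rightarrow> 'b set \<Rightarrow> 'b set
      \<Rightarrow> ('a \<Rightarrow> 'b set) \<Rightarrow> bool" where
  "bipartite_cover G A\<^sub>G B\<^sub>G H A\<^sub>H B\<^sub>H L \<longleftrightarrow>
     bipartite_graph G A\<^sub>G B\<^sub>G \<and> bipartite_graph H A\<^sub>H B\<^sub>H \<and>
     partition_by (pverts G) L (pverts H) \<and>
     (\<forall>v\<in>pverts G. \<forall>v'\<in>pverts G. (v, v') \<notin> parcs G \<longrightarrow> edges_between H (L v) (L v') = {}) \<and>
     partition_by A\<^sub>G L A\<^sub>H \<and> partition_by B\<^sub>G L B\<^sub>H"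

definition bipartite_correspondence_cover ::
    "'a pair_pre_digraph \<Rightarrow> 'a set \<Rightarrow> 'a set \<Rightarrow> 'b pair_pre_digraph \<Rightarrow> 'b set \<Rightarrow> 'b set
      \<Rightarrow> ('a \<Rightarrow> 'b set) \<Rightarrow> bool" where
  "bipartite_correspondence_cover G A\<^sub>G B\<^sub>G H A\<^sub>H B\<^sub>H L \<longleftrightarrow>
     bipartite_cover G A\<^sub>G B\<^sub>G H A\<^sub>H B\<^sub>H L \<and>
     (\<forall>(v, v')\<in>parcs G. bipartite_matching (edges_between H (L v) (L v')))"

definition independent_set :: "'a pair_pre_digraph \<Rightarrow> 'a set \<Rightarrow> bool" where
  "independent_set H S \<longleftrightarrow> S \<subseteq> pverts H \<and> (\<forall>x\<in>S. \<forall>y\<in>S. (x, y) \<notin> parcs H)"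

definition independent_transversal ::
    "'a pair_pre_digraph \<Rightarrow> 'b pair_pre_digraph \<Rightarrow> ('a \<Rightarrow> 'b set) \<Rightarrow> 'b set \<Rightarrow> bool" where
  "independent_transversal G H L S \<longleftrightarrow>
     independent_set H S \<and> (\<forall>v\<in>pverts G. \<exists>!x. x \<in> S \<inter> L v)"

end

theory Submission
  imports Defs "HOL-Library.Nat_Bijection"
begin

text \<open>
  Write \<open>\<Delta> = 4 ^ m = 2 * m * h\<close>, so that the lists on the first side must have size
  \<open>\<Delta> / m = 2 * h\<close>. Take \<open>G\<close> to be the complete bipartite graph with \<open>\<Delta>\<close> vertices on each side.
  Choosing one of the two colours at every vertex of the second side amounts to choosing a
  vector \<open>b\<close> of \<open>\<Delta>\<close> bits. Cut the \<open>\<Delta>\<close> coordinates into \<open>h\<close> blocks of \<open>2 * m\<close> coordinates, and let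
  every vertex \<open>v\<close> of the first side own two colours for each block: in \<open>H\<close>, colour 1 of block \<open>g\<close> is
  joined to the value 1, and colour 0 to the value 0, of each coordinate in block \<open>g\<close>, after the
  values have been flipped according to a shift vector \<open>s v\<close>. Each coordinate then contributes a
  matching, and \<open>v\<close> has a colour that is left free by \<open>b\<close> precisely when the shifted vector
  \<open>b + s v\<close> (modulo 2) is constant on some block.

  Only a fraction of at most \<open>h * 2 / 2 ^ (2 * m) = 1 / m\<close> of all vectors are constant on some
  block (\<open>card_constant_on_some_block\<close>). The shifts are now chosen one vertex at a time.
  Averaged over all shifts, a new vertex keeps at most a \<open>1 / m\<close> fraction of the vectors \<open>b\<close> that all
  earlier vertices tolerate, so some shift does at least as well
  (\<open>exists_translate_few_in_target\<close>). After \<open>\<Delta>\<close> vertices at most \<open>(2 / m) ^ \<Delta>\<close> vectors survive,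
  which is less than one as soon as \<open>m > 2\<close>: no choice on the second side extends to an independent
  transversal.

  The number \<open>2 * h = 4 ^ m / m\<close> is an even integer whenever \<open>m\<close> is a power of two and \<open>m > 2\<close>,
  which yields infinitely many \<open>\<Delta>\<close>.
\<close>

section \<open>Translates of a sparse family of bit vectors\<close>

text \<open>
  Bit vectors indexed by \<open>U\<close> are represented by subsets of \<open>U\<close>, and their addition modulo 2 by
  symmetric difference. The proof is double counting: for fixed \<open>b\<close> the map from \<open>s\<close> to
  \<open>sym_diff b s\<close> is injective, so at most \<open>card (T \<inter> Pow U)\<close> translations send \<open>b\<close> into \<open>T\<close>, and
  some \<open>s\<close> does no worse than the average over all \<open>2 ^ card U\<close> translations.
\<close>

lemma exists_translate_few_in_target:
  assumes "finite U" and "S \<subseteq> Pow U"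
  shows "\<exists>s\<subseteq>U. card {b \<in> S. sym_diff b s \<in> T} * 2 ^ card U \<le> card S * card (T \<inter> Pow U)"
proof (rule ccontr)
  assume "\<not> ?thesis"
  then have *: "card S * card (T \<inter> Pow U) < card {b \<in> S. sym_diff b s \<in> T} * 2 ^ card U"
    if "s \<in> Pow U" for s
    using that by (meson PowD not_le)
  have fin: "finite S" "finite (Pow U)"
    using assms by (auto intro: finite_subset)
  have translates: "card {s \<in> Pow U. sym_diff b s \<in> T} \<le> card (T \<inter> Pow U)" if "b \<in> S" for b
  proof (rule card_inj_on_le[where f = "sym_diff b"])
    show "inj_on (sym_diff b) {s \<in> Pow U. sym_diff b s \<in> T}"
      by (rule inj_onI) blast
    show "sym_diff b ` {s \<in> Pow U. sym_diff b s \<in> T} \<subseteq> T \<inter> Pow U"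
      using assms that by blast
    show "finite (T \<inter> Pow U)"
      using fin by blast
  qed
  have "(\<Sum>s\<in>Pow U. card {b \<in> S. sym_diff b s \<in> T})
      = (\<Sum>b\<in>S. card {s \<in> Pow U. sym_diff b s \<in> T})"
    by (rule sum_multicount_gen) (use fin in auto)
  also have "\<dots> \<le> card S * card (T \<inter> Pow U)"
    using sum_bounded_above[of S, OF translates] by simp
  finally have upper: "(\<Sum>s\<in>Pow U. card {b \<in> S. sym_diff b s \<in> T}) \<le> card S * card (T \<inter> Pow U)" .
  have "(\<Sum>s\<in>Pow U. card S * card (T \<inter> Pow U))
      < (\<Sum>s\<in>Pow U. card {b \<in> S. sym_diff b s \<in> T} * 2 ^ card U)"
    by (rule sum_strict_mono) (use * fin in auto)
  also have "\<dots> = (\<Sum>s\<in>Pow U. card {b \<in> S. sym_diff b s \<in> T}) * 2 ^ card U"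
    by (simp add: sum_distrib_right)
  also have "\<dots> \<le> card S * card (T \<inter> Pow U) * 2 ^ card U"
    using upper by simp
  finally show False
    using assms(1) by (simp add: card_Pow)
qed

text \<open>
  Greedy choice of the translations: each new one retains at most a \<open>1 / m\<close> fraction of the vectors
  that all previous ones send into \<open>T\<close>.
\<close>

lemma exists_translates_few_in_all:
  fixes m n :: nat
  assumes fin: "finite U" and sparse: "card (T \<inter> Pow U) * m \<le> 2 ^ card U"
  shows "\<exists>s. (\<forall>i. s i \<subseteq> U) \<and>
    card {b \<in> Pow U. \<forall>i<n. sym_diff b (s i) \<in> T} * m ^ n \<le> 2 ^ card U"
proof (induction n)
  case 0
  show ?case
    by (rule exI[of _ "\<lambda>_. {}"]) (use card_Pow[OF fin] in \<open>simp add: Pow_def\<close>)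
next
  case (Suc n)
  then obtain s where s: "\<And>i. s i \<subseteq> U"
    and IH: "card {b \<in> Pow U. \<forall>i<n. sym_diff b (s i) \<in> T} * m ^ n \<le> 2 ^ card U"
    by blast
  define S where "S = {b \<in> Pow U. \<forall>i<n. sym_diff b (s i) \<in> T}"
  obtain t where "t \<subseteq> U"
    and t: "card {b \<in> S. sym_diff b t \<in> T} * 2 ^ card U \<le> card S * card (T \<inter> Pow U)"
    using exists_translate_few_in_target[OF fin, of S T] by (auto simp: S_def)
  have eq: "{b \<in> Pow U. \<forall>i<Suc n. sym_diff b ((s(n := t)) i) \<in> T} = {b \<in> S. sym_diff b t \<in> T}"
    by (auto simp: S_def less_Suc_eq)
  have "card {b \<in> S. sym_diff b t \<in> T} * m ^ Suc n * 2 ^ card U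
      \<le> card S * card (T \<inter> Pow U) * m ^ Suc n"
    using mult_right_mono[OF t, of "m ^ Suc n"] by (simp add: ac_simps)
  also have "\<dots> = (card (T \<inter> Pow U) * m) * (card S * m ^ n)"
    by simp
  also have "\<dots> \<le> 2 ^ card U * 2 ^ card U"
    using sparse IH by (intro mult_mono) (auto simp: S_def)
  finally have "card {b \<in> S. sym_diff b t \<in> T} * m ^ Suc n \<le> 2 ^ card U"
    by simp
  with eq s \<open>t \<subseteq> U\<close> show ?case
    by (intro exI[of _ "s(n := t)"]) auto
qed

text \<open>
  With as many translations as there are coordinates, the number of surviving vectors is at most
  \<open>2 ^ card U / m ^ card U\<close> and hence zero.
\<close>

lemma exists_translates_avoiding:
  fixes m :: nat
  assumes fin: "finite U" and ne: "U \<noteq> {}" and "2 < m"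
    and sparse: "card (T \<inter> Pow U) * m \<le> 2 ^ card U"
  shows "\<exists>s. (\<forall>i. s i \<subseteq> U) \<and> (\<forall>b\<subseteq>U. \<exists>i<card U. sym_diff b (s i) \<notin> T)"
proof -
  define N where "N = card U"
  obtain s where sU: "\<forall>i. s i \<subseteq> U"
    and s: "card {b \<in> Pow U. \<forall>i<N. sym_diff b (s i) \<in> T} * m ^ N \<le> 2 ^ N"
    using exists_translates_few_in_all[OF fin sparse, of N] unfolding N_def by blast
  have "0 < N"
    using fin ne by (simp add: N_def card_gt_0_iff)
  then have "(2::nat) ^ N < m ^ N"
    using \<open>2 < m\<close> by (intro power_strict_mono) auto
  with s have "card {b \<in> Pow U. \<forall>i<N. sym_diff b (s i) \<in> T} * m ^ N < 1 * m ^ N"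
    by linarith
  then have "card {b \<in> Pow U. \<forall>i<N. sym_diff b (s i) \<in> T} = 0"
    unfolding mult_less_cancel2 by simp
  with fin have "{b \<in> Pow U. \<forall>i<N. sym_diff b (s i) \<in> T} = {}"
    by simp
  then have "\<exists>i<N. sym_diff b (s i) \<notin> T" if "b \<subseteq> U" for b
    using that by blast
  with sU show ?thesis
    unfolding N_def by (intro exI[of _ s] conjI allI impI) simp_all
qed

section \<open>Bit vectors that are constant on a block\<close>

text \<open>
  Union bound: a vector that is constant on \<open>P g\<close> is determined by that constant and by its
  values on the remaining \<open>card U - q\<close> coordinates.
\<close>

lemma card_constant_on_some_block:
  assumes fin: "finite U" "finite I"
    and blocks: "\<And>g. g \<in> I \<Longrightarrow> P g \<subseteq> U" "\<And>g. g \<in> I \<Longrightarrow> card (P g) = q"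
  shows "card {b \<in> Pow U. \<exists>g\<in>I. P g \<subseteq> b \<or> P g \<inter> b = {}} \<le> card I * (2 * 2 ^ (card U - q))"
proof -
  have one: "card ({b \<in> Pow U. P g \<subseteq> b} \<union> {b \<in> Pow U. P g \<inter> b = {}}) \<le> 2 * 2 ^ (card U - q)"
    if g: "g \<in> I" for g
  proof -
    have c: "card (Pow (U - P g)) = 2 ^ (card U - q)"
      using fin blocks[OF g] by (simp add: card_Pow card_Diff_subset finite_subset)
    have "{b \<in> Pow U. P g \<subseteq> b} = (\<lambda>b. b \<union> P g) ` Pow (U - P g)"
    proof (intro equalityI subsetI)
      fix b assume "b \<in> {b \<in> Pow U. P g \<subseteq> b}"
      then show "b \<in> (\<lambda>b. b \<union> P g) ` Pow (U - P g)"
        by (intro image_eqI[of _ _ "b - P g"]) auto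
    qed (use blocks(1)[OF g] in auto)
    then have "card {b \<in> Pow U. P g \<subseteq> b} \<le> 2 ^ (card U - q)"
      using card_image_le[of "Pow (U - P g)" "\<lambda>b. b \<union> P g"] c fin by simp
    moreover have "{b \<in> Pow U. P g \<inter> b = {}} = Pow (U - P g)"
      by blast
    ultimately show ?thesis
      using c card_Un_le[of "{b \<in> Pow U. P g \<subseteq> b}" "{b \<in> Pow U. P g \<inter> b = {}}"] by simp
  qed
  have "{b \<in> Pow U. \<exists>g\<in>I. P g \<subseteq> b \<or> P g \<inter> b = {}}
      = (\<Union>g\<in>I. {b \<in> Pow U. P g \<subseteq> b} \<union> {b \<in> Pow U. P g \<inter> b = {}})"
    by blast
  then have "card {b \<in> Pow U. \<exists>g\<in>I. P g \<subseteq> b \<or> P g \<inter> b = {}}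
      \<le> (\<Sum>g\<in>I. card ({b \<in> Pow U. P g \<subseteq> b} \<union> {b \<in> Pow U. P g \<inter> b = {}}))"
    by (simp only: card_UN_le[OF fin(2)])
  also have "\<dots> \<le> card I * (2 * 2 ^ (card U - q))"
    using sum_bounded_above[of I, OF one] by simp
  finally show ?thesis .
qed

definition block :: "nat \<Rightarrow> nat \<Rightarrow> nat set" where
  "block q g = {q * g..<q * Suc g}"

text \<open>
  The two equations for \<open>D\<close> are what makes the union bound come out as a \<open>1 / m\<close> fraction:
  \<open>h * 2 * 2 ^ (D - 2 * m) * m = D * 2 ^ D / 4 ^ m = 2 ^ D\<close>.
\<close>

lemma exists_shifts_nonconstant_on_blocks:
  fixes D m h :: nat
  assumes D: "D = 4 ^ m" "D = 2 * m * h" and "2 < m"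
  shows "\<exists>s. \<forall>b\<subseteq>{..<D}. \<exists>v<D. \<forall>g<h.
    \<not> block (2 * m) g \<subseteq> sym_diff b (s v) \<and> block (2 * m) g \<inter> sym_diff b (s v) \<noteq> {}"
proof -
  define T where
    "T = {b \<in> Pow {..<D}. \<exists>g\<in>{..<h}. block (2 * m) g \<subseteq> b \<or> block (2 * m) g \<inter> b = {}}"
  have inU: "block (2 * m) g \<subseteq> {..<D}" if "g \<in> {..<h}" for g
  proof -
    have "2 * m * Suc g \<le> D"
      unfolding D(2) using that by (intro mult_le_mono) auto
    then show ?thesis
      by (auto simp: block_def)
  qed
  have "2 * m \<le> D"
    using D by (cases h) auto
  have "card T \<le> card {..<h} * (2 * 2 ^ (card {..<D} - 2 * m))"
    unfolding T_def
  proof (rule card_constant_on_some_block)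
    show "card (block (2 * m) g) = 2 * m" for g
      by (simp add: block_def)
  qed (use inU in simp_all)
  then have "card T * m \<le> h * (2 * 2 ^ (D - 2 * m)) * m"
    by simp
  also have "\<dots> = D * 2 ^ (D - 2 * m)"
    by (simp add: D(2))
  also have "\<dots> = 2 ^ (2 * m) * 2 ^ (D - 2 * m)"
    by (simp add: D(1) power_mult)
  also have "\<dots> = 2 ^ D"
    using \<open>2 * m \<le> D\<close> by (simp flip: power_add)
  finally have "card T * m \<le> 2 ^ card {..<D}"
    by simp
  moreover have "T \<inter> Pow {..<D} = T"
    by (auto simp: T_def)
  moreover have "{..<D} \<noteq> {}"
    by (simp add: lessThan_empty_iff D(1))
  ultimately obtain s where sU: "\<forall>v. s v \<subseteq> {..<D}"
    and s: "\<forall>b\<subseteq>{..<D}. \<exists>v<card {..<D}. sym_diff b (s v) \<notin> T"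
    using exists_translates_avoiding[of "{..<D}" m T] \<open>2 < m\<close> by (metis finite_lessThan)
  show ?thesis
  proof (rule exI[of _ s], intro allI impI)
    fix b assume b: "b \<subseteq> {..<D}"
    with s obtain v where v: "v < D" "sym_diff b (s v) \<notin> T"
      by auto
    moreover have "sym_diff b (s v) \<in> Pow {..<D}"
      using b sU by blast
    ultimately have "\<not> (\<exists>g\<in>{..<h}. block (2 * m) g \<subseteq> sym_diff b (s v)
        \<or> block (2 * m) g \<inter> sym_diff b (s v) = {})"
      unfolding T_def by simp
    with v(1) show "\<exists>v<D. \<forall>g<h. \<not> block (2 * m) g \<subseteq> sym_diff b (s v)
        \<and> block (2 * m) g \<inter> sym_diff b (s v) \<noteq> {}"
      by (intro exI[of _ v]) auto
  qed
qed

section \<open>Bipartite graphs and correspondence-covers given by conflicts\<close>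

definition bipartite_pair_graph :: "'a set \<Rightarrow> 'a set \<Rightarrow> ('a \<times> 'a) set \<Rightarrow> 'a pair_pre_digraph" where
  "bipartite_pair_graph A B R = \<lparr>pverts = A \<union> B, parcs = R \<union> R\<inverse>\<rparr>"

lemma bipartite_graph_bipartite_pair_graph:
  assumes "finite A" "finite B" "A \<inter> B = {}" "R \<subseteq> A \<times> B"
  shows "bipartite_graph (bipartite_pair_graph A B R) A B"
proof -
  have fin: "finite R"
    using assms finite_subset by blast
  have "pair_graph (bipartite_pair_graph A B R)"
    by unfold_locales
      (use assms fin in \<open>auto simp: bipartite_pair_graph_def symmetric_def sym_def arcs_ends_def arc_to_ends_def\<close>)
  then show ?thesis
    using assms by (auto simp: bipartite_graph_def bipartite_pair_graph_def)
qed

lemma max_degree_balanced_complete_bipartite: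
  assumes "finite A" "A \<noteq> {}" "A \<inter> B = {}" "card B = card A"
  shows "max_degree (bipartite_pair_graph A B (A \<times> B)) = card A"
proof -
  let ?G = "bipartite_pair_graph A B (A \<times> B)"
  have "out_degree (with_proj ?G) v = card A" if "v \<in> A \<union> B" for v
  proof -
    have "out_arcs (with_proj ?G) v = {v} \<times> (if v \<in> A then B else A)"
      using assms(3) that by (auto simp: out_arcs_def bipartite_pair_graph_def)
    then show ?thesis
      using assms(4) by (simp add: out_degree_def card_cartesian_product_singleton)
  qed
  then have "out_degree (with_proj ?G) ` pverts ?G = {card A}"
    using assms(2) by (auto simp: bipartite_pair_graph_def)
  then show ?thesis
    by (simp add: max_degree_def)
qed

text \<open>
  The vertices of the covering graph are pairs of a vertex and a colour index, coded as natural
  numbers, so that the lists of different vertices are automatically disjoint.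
\<close>

definition colour_list :: "(nat \<Rightarrow> nat) \<Rightarrow> nat \<Rightarrow> nat set" where
  "colour_list k v = (\<lambda>j. prod_encode (v, j)) ` {..<k v}"

lemma card_colour_list [simp]: "card (colour_list k v) = k v"
  by (simp add: colour_list_def card_image inj_on_def)

lemma prod_encode_in_colour_list [simp]:
  "prod_encode (u, j) \<in> colour_list k v \<longleftrightarrow> u = v \<and> j < k v"
  by (auto simp: colour_list_def)

lemma partition_by_colour_list:
  assumes "\<And>v. v \<in> I \<Longrightarrow> 0 < k v"
  shows "partition_by I (colour_list k) (\<Union>v\<in>I. colour_list k v)"
proof -
  have "colour_list k v \<noteq> {}" if "v \<in> I" for v
    using assms[OF that] by (auto simp: colour_list_def)
  moreover have "disjoint_family_on (colour_list k) I"
    by (auto simp: disjoint_family_on_def colour_list_def)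
  ultimately show ?thesis
    by (simp add: partition_by_def)
qed

text \<open>
  \<open>C v j w d\<close> says that colour \<open>j\<close> at \<open>v\<close> conflicts with colour \<open>d\<close> at \<open>w\<close>; only the orientation
  from the first side to the second is recorded.
\<close>

definition conflict_arcs :: "(nat \<Rightarrow> nat \<Rightarrow> nat \<Rightarrow> nat \<Rightarrow> bool) \<Rightarrow> (nat \<times> nat) set" where
  "conflict_arcs C = {(prod_encode (v, j), prod_encode (w, d)) | v j w d. C v j w d}"

text \<open>
  Over a complete bipartite graph no pair of lists from opposite sides is forbidden to carry
  edges, so being a correspondence-cover reduces to the conflict relation being, for each
  \<open>v\<close> and \<open>w\<close>, a partial injection between colour indices.
\<close>

lemma bipartite_correspondence_cover_conflict_arcs:
  fixes C :: "nat \<Rightarrow> nat \<Rightarrow> nat \<Rightarrow> nat \<Rightarrow> bool"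
    and k :: "nat \<Rightarrow> nat"
  defines "L \<equiv> colour_list k"
  assumes fin: "finite A" "finite B" and disj: "A \<inter> B = {}"
    and pos: "\<And>v. v \<in> A \<union> B \<Longrightarrow> 0 < k v"
    and wf: "\<And>v j w d. C v j w d \<Longrightarrow> v \<in> A \<and> j < k v \<and> w \<in> B \<and> d < k w"
    and left_unique: "\<And>v j j' w d. C v j w d \<Longrightarrow> C v j' w d \<Longrightarrow> j = j'"
    and right_unique: "\<And>v j w d d'. C v j w d \<Longrightarrow> C v j w d' \<Longrightarrow> d = d'"
  shows "bipartite_correspondence_cover (bipartite_pair_graph A B (A \<times> B)) A B
    (bipartite_pair_graph (\<Union>v\<in>A. L v) (\<Union>w\<in>B. L w) (conflict_arcs C))
    (\<Union>v\<in>A. L v) (\<Union>w\<in>B. L w) L"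
proof -
  let ?G = "bipartite_pair_graph A B (A \<times> B)"
  let ?H = "bipartite_pair_graph (\<Union>v\<in>A. L v) (\<Union>w\<in>B. L w) (conflict_arcs C)"
  have G: "bipartite_graph ?G A B"
    using fin disj by (intro bipartite_graph_bipartite_pair_graph) auto
  have "(\<Union>v\<in>A. L v) \<inter> (\<Union>w\<in>B. L w) = {}"
    using disj by (auto simp: L_def colour_list_def)
  moreover have "conflict_arcs C \<subseteq> (\<Union>v\<in>A. L v) \<times> (\<Union>w\<in>B. L w)"
    using wf by (auto simp: conflict_arcs_def L_def)
  moreover have "finite (\<Union>v\<in>A. L v)" "finite (\<Union>w\<in>B. L w)"
    using fin by (auto simp: L_def colour_list_def)
  ultimately have H: "bipartite_graph ?H (\<Union>v\<in>A. L v) (\<Union>w\<in>B. L w)"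
    by (intro bipartite_graph_bipartite_pair_graph) auto
  have parts: "partition_by (pverts ?G) L (pverts ?H)" "partition_by A L (\<Union>v\<in>A. L v)"
    "partition_by B L (\<Union>w\<in>B. L w)"
    unfolding L_def
    using partition_by_colour_list[of "A \<union> B" k, OF pos] partition_by_colour_list[of A k, OF pos]
      partition_by_colour_list[of B k, OF pos]
    by (simp_all add: bipartite_pair_graph_def UN_Un)
  have between: "e \<in> edges_between ?H (L v) (L v') \<longleftrightarrow>
      (\<exists>j d. e = (prod_encode (v, j), prod_encode (v', d)) \<and> (C v j v' d \<or> C v' d v j))" for e v v'
  proof -
    have "e \<in> edges_between ?H (L v) (L v') \<longleftrightarrow>
        e \<in> (conflict_arcs C \<union> (conflict_arcs C)\<inverse>) \<inter> L v \<times> L v'"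
      by (simp add: edges_between_def bipartite_pair_graph_def)
    also have "\<dots> \<longleftrightarrow> (\<exists>j d. e = (prod_encode (v, j), prod_encode (v', d))
        \<and> (C v j v' d \<or> C v' d v j))"
      using wf by (auto simp: conflict_arcs_def L_def)
    finally show ?thesis .
  qed
  have "edges_between ?H (L v) (L v') = {}"
    if "v \<in> pverts ?G" "v' \<in> pverts ?G" "(v, v') \<notin> parcs ?G" for v v'
    using that between[of _ v v'] wf by (auto simp: bipartite_pair_graph_def)
  moreover have "bipartite_matching (edges_between ?H (L v) (L v'))" for v v'
    unfolding bipartite_matching_def
  proof (intro ballI impI)
    fix e e' assume *: "e \<in> edges_between ?H (L v) (L v')" "e' \<in> edges_between ?H (L v) (L v')" "e \<noteq> e'"
    then obtain j d j' d' where
      e: "e = (prod_encode (v, j), prod_encode (v', d))" "C v j v' d \<or> C v' d v j" and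
      e': "e' = (prod_encode (v, j'), prod_encode (v', d'))" "C v j' v' d' \<or> C v' d' v j'"
      unfolding between by blast
    have "\<not> (C v a v' b \<and> C v' b' v a')" for a b a' b'
      using wf[of v a v' b] wf[of v' b' v a'] disj by blast
    with e(2) e'(2) consider "C v j v' d" "C v j' v' d'" | "C v' d v j" "C v' d' v j'"
      by blast
    then have "j = j' \<longleftrightarrow> d = d'"
    proof cases
      case 1
      then show ?thesis
        using left_unique[of v j v' d j'] right_unique[of v j v' d d'] by blast
    next
      case 2
      then show ?thesis
        using left_unique[of v' d v j d'] right_unique[of v' d v j j'] by blast
    qed
    with * e(1) e'(1) show "fst e \<noteq> fst e' \<and> snd e \<noteq> snd e'"
      by auto
  qed
  ultimately show ?thesis
    using G H parts by (auto simp: bipartite_correspondence_cover_def bipartite_cover_def)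
qed

text \<open>
  An independent transversal is read as a conflict-free colouring \<open>f\<close>, so that the
  main argument can be carried out without the coding of colours by natural numbers.
\<close>

lemma independent_transversal_choice:
  assumes S: "independent_transversal (bipartite_pair_graph A B R)
    (bipartite_pair_graph A' B' (conflict_arcs C)) (colour_list k) S"
  shows "\<exists>f. (\<forall>v\<in>A \<union> B. f v < k v) \<and> (\<forall>v\<in>A \<union> B. \<forall>w\<in>A \<union> B. \<not> C v (f v) w (f w))"
proof -
  have "\<forall>v\<in>A \<union> B. \<exists>j. j < k v \<and> prod_encode (v, j) \<in> S"
    using S unfolding independent_transversal_def
    by (fastforce simp: bipartite_pair_graph_def colour_list_def)
  then obtain f where f: "\<forall>v\<in>A \<union> B. f v < k v \<and> prod_encode (v, f v) \<in> S"
    by metis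
  have "\<not> C v (f v) w (f w)" if "v \<in> A \<union> B" "w \<in> A \<union> B" for v w
  proof
    assume "C v (f v) w (f w)"
    then have "(prod_encode (v, f v), prod_encode (w, f w)) \<in> conflict_arcs C"
      by (auto simp: conflict_arcs_def)
    then show False
      using S f that unfolding independent_transversal_def independent_set_def
      by (auto simp: bipartite_pair_graph_def)
  qed
  with f show ?thesis
    by blast
qed

section \<open>Covers without independent transversals\<close>

text \<open>
  Vertices \<open>v < D\<close> form the first side, and coordinate \<open>u < D\<close> is the vertex \<open>D + u\<close> of the second
  side. Colour \<open>2 * g + c\<close> at \<open>v\<close> stands for the value \<open>c\<close> on block \<open>g\<close>. If \<open>f\<close> chooses that colour
  at \<open>v\<close> while the shifted vector is not constant on block \<open>g\<close>, then some coordinate of the block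
  carries the value \<open>c\<close> and conflicts with the choice.
\<close>

lemma exists_cover_without_independent_transversal:
  fixes D m h :: nat
  assumes D: "D = 4 ^ m" "D = 2 * m * h" and "2 < m"
  shows "\<exists>(G :: nat pair_pre_digraph) A\<^sub>G B\<^sub>G (H :: nat pair_pre_digraph) A\<^sub>H B\<^sub>H (L :: nat \<Rightarrow> nat set).
    bipartite_correspondence_cover G A\<^sub>G B\<^sub>G H A\<^sub>H B\<^sub>H L \<and> max_degree G = D \<and>
    (\<forall>v\<in>A\<^sub>G. card (L v) = 2 * h) \<and> (\<forall>w\<in>B\<^sub>G. card (L w) = 2) \<and>
    \<not> (\<exists>S. independent_transversal G H L S)"
proof -
  obtain s where s: "\<And>b. b \<subseteq> {..<D} \<Longrightarrow> \<exists>v<D. \<forall>g<h.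
      \<not> block (2 * m) g \<subseteq> sym_diff b (s v) \<and> block (2 * m) g \<inter> sym_diff b (s v) \<noteq> {}"
    using exists_shifts_nonconstant_on_blocks[OF assms] by blast
  define A where "A = {..<D}"
  define B where "B = {D..<2 * D}"
  define k where "k v = (if v < D then 2 * h else 2)" for v
  \<comment> \<open>The colour of \<open>v\<close> in conflict with \<open>d\<close> at \<open>w\<close>: the block of \<open>w\<close>, and \<open>d\<close> flipped by \<open>s v\<close>.\<close>
  define C where "C v j w d \<longleftrightarrow> v \<in> A \<and> w \<in> B \<and> d < 2 \<and>
    j = 2 * ((w - D) div (2 * m)) + (if w - D \<in> s v then 1 - d else d)" for v j w d
  define G where "G = bipartite_pair_graph A B (A \<times> B)"
  define H where "H = bipartite_pair_graph (\<Union>v\<in>A. colour_list k v)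
    (\<Union>w\<in>B. colour_list k w) (conflict_arcs C)"
  have "0 < D"
    using D(1) by simp
  then have "0 < h"
    using D(2) by (cases h) auto
  have cover: "bipartite_correspondence_cover G A B H
      (\<Union>v\<in>A. colour_list k v) (\<Union>w\<in>B. colour_list k w) (colour_list k)"
    unfolding G_def H_def
  proof (rule bipartite_correspondence_cover_conflict_arcs)
    fix v j w d assume C: "C v j w d"
    then have "(w - D) div (2 * m) < h"
      using D(2) by (auto simp: C_def B_def less_mult_imp_div_less mult.commute)
    with C show "v \<in> A \<and> j < k v \<and> w \<in> B \<and> d < k w"
      by (auto simp: C_def k_def A_def B_def)
  next
    fix v j w d d' assume "C v j w d" "C v j w d'"
    then show "d = d'"
      by (auto simp: C_def split: if_splits)
  qed (use \<open>0 < h\<close> in \<open>auto simp: A_def B_def k_def C_def\<close>)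
  have degree: "max_degree G = D"
    using max_degree_balanced_complete_bipartite[of A B] \<open>0 < D\<close>
    by (force simp: G_def A_def B_def)
  have none: "\<not> independent_transversal G H (colour_list k) S" for S
  proof
    assume "independent_transversal G H (colour_list k) S"
    then obtain f where f: "\<And>v. v \<in> A \<union> B \<Longrightarrow> f v < k v"
      and indep: "\<And>v w. v \<in> A \<union> B \<Longrightarrow> w \<in> A \<union> B \<Longrightarrow> \<not> C v (f v) w (f w)"
      unfolding G_def H_def by (blast dest: independent_transversal_choice)
    define b where "b = {u. u < D \<and> f (D + u) = 1}"
    obtain v where v: "v < D" and mixed: "\<And>g. g < h \<Longrightarrow>
        \<not> block (2 * m) g \<subseteq> sym_diff b (s v) \<and> block (2 * m) g \<inter> sym_diff b (s v) \<noteq> {}"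
      using s[of b] by (auto simp: b_def)
    define g where "g = f v div 2"
    have "g < h"
      using f[of v] v by (auto simp: g_def k_def A_def)
    obtain u where u: "u \<in> block (2 * m) g" "u \<in> sym_diff b (s v) \<longleftrightarrow> f v mod 2 = 1"
    proof (cases "f v mod 2 = 1")
      case True
      with mixed[OF \<open>g < h\<close>] that show ?thesis
        by (metis disjoint_iff)
    next
      case False
      with mixed[OF \<open>g < h\<close>] that show ?thesis
        by (metis subsetI)
    qed
    have "2 * m * Suc g \<le> D"
      unfolding D(2) using \<open>g < h\<close> by (intro mult_le_mono) auto
    with u(1) have "u < D"
      by (auto simp: block_def)
    have "u div (2 * m) = g"
      using u(1) by (intro div_nat_eqI) (auto simp: block_def ac_simps)
    have "f (D + u) < 2"
      using f[of "D + u"] \<open>u < D\<close> by (auto simp: B_def k_def)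
    have "f v = 2 * g + f v mod 2"
      by (simp add: g_def)
    also have "f v mod 2 = (if u \<in> s v then 1 - f (D + u) else f (D + u))"
      using u(2) \<open>u < D\<close> \<open>f (D + u) < 2\<close> by (auto simp: b_def less_2_cases_iff)
    finally have "C v (f v) (D + u) (f (D + u))"
      using v \<open>u < D\<close> \<open>f (D + u) < 2\<close> \<open>u div (2 * m) = g\<close> by (simp add: C_def A_def B_def)
    with indep show False
      using v \<open>u < D\<close> by (auto simp: A_def B_def)
  qed
  from cover degree none show ?thesis
    by (intro exI[of _ G] exI[of _ A] exI[of _ B] exI[of _ H] exI conjI) (auto simp: A_def B_def k_def)
qed

theorem proposition6:
  shows "infinite {\<Delta>::nat. \<Delta> > 0 \<and>
    (\<exists>(G :: nat pair_pre_digraph) A\<^sub>G B\<^sub>G (H :: nat pair_pre_digraph) A\<^sub>H B\<^sub>H (L :: nat \<Rightarrow> nat set).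
      bipartite_correspondence_cover G A\<^sub>G B\<^sub>G H A\<^sub>H B\<^sub>H L \<and>
      max_degree G = \<Delta> \<and>
      (\<forall>v\<in>A\<^sub>G. real (card (L v)) = real \<Delta> / log 4 (real \<Delta>)) \<and>
      (\<forall>w\<in>B\<^sub>G. card (L w) = 2) \<and>
      \<not> (\<exists>S. independent_transversal G H L S))}"
    (is "infinite {\<Delta>. ?P \<Delta>}")
proof -
  \<comment> \<open>The exponent \<open>m = 2 ^ (r + 2)\<close> divides \<open>4 ^ m\<close> with even quotient, and it exceeds 2.\<close>
  define D :: "nat \<Rightarrow> nat" where "D r = 4 ^ 2 ^ (r + 2)" for r
  have "?P (D r)" for r
  proof -
    define m :: nat where "m = 2 ^ (r + 2)"
    have "r + 3 \<le> 2 * m"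
      using less_exp[of "r + 2"] by (simp add: m_def)
    define h :: nat where "h = 2 ^ (2 * m - (r + 3))"
    have "2 * m * h = 2 ^ (r + 3) * h"
      by (simp add: m_def power_add)
    also have "\<dots> = 4 ^ m"
      unfolding h_def using \<open>r + 3 \<le> 2 * m\<close> by (simp add: power_mult flip: power_add)
    finally have D: "D r = 4 ^ m" "D r = 2 * m * h"
      by (simp_all add: D_def m_def)
    have "2 < m"
      using less_exp[of "r + 2"] by (simp add: m_def power_add)
    have "log 4 (real (D r)) = m"
      by (simp add: D(1) log_nat_power)
    then have list_size: "real (D r) / log 4 (real (D r)) = real (2 * h)"
      using \<open>2 < m\<close> by (simp add: D(2))
    have "D r > 0"
      by (simp add: D_def)
    with exists_cover_without_independent_transversal[OF D \<open>2 < m\<close>] show ?thesis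
      unfolding list_size by (simp only: of_nat_eq_iff simp_thms)
  qed
  then have "range D \<subseteq> {\<Delta>. ?P \<Delta>}"
    by blast
  moreover have "inj D"
    by (rule injI) (simp add: D_def power_inject_exp)
  then have "infinite (range D)"
    by (rule range_inj_infinite)
  ultimately show ?thesis
    by (rule infinite_super)
qed

end
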